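(* If $G$ is a graph with $m$ edges and without isolated vertices, then $r(G) \leq 2^{250\sqrt{m}}$.
   Context: Graphs are finite and simple. The Ramsey number $r(G)$ of a graph $G$ is the smallest natural number $N$ such that every red-blue coloring of the edges of the complete graph $K_N$ on $N$ vertices contains a monochromatic copy of $G$, i.e. a (not necessarily induced) subgraph isomorphic to $G$ all of whose edges have the same color. *)

theory Defs
  imports Complex_Main "HOL-Library.Ramsey"
begin

type_synonym 'v graph = "'v set \<times> 'v set set"

abbreviation verts :: "'v graph \<Rightarrow> 'v set" where
  "verts G \<equiv> fst G"

abbreviation edges :: "'v graph \<Rightarrow> 'v set set" where
  "edges G \<equiv> snd G"

definition simple_graph :: "'v graph \<Rightarrow> bool" where
  "simple_graph G \<longleftrightarrow> finite (verts G) \<and> edges G \<subseteq> nsets (verts G) 2"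

definition isolated_vertex :: "'v graph \<Rightarrow> 'v \<Rightarrow> bool" where
  "isolated_vertex G v \<longleftrightarrow> v \<in> verts G \<and> (\<forall>e\<in>edges G. v \<notin> e)"

definition complete_graph :: "nat \<Rightarrow> nat graph" where
  "complete_graph N = ({..<N}, nsets {..<N} 2)"

definition subgraph :: "'v graph \<Rightarrow> 'v graph \<Rightarrow> bool" where
  "subgraph H K \<longleftrightarrow> simple_graph H \<and> verts H \<subseteq> verts K \<and> edges H \<subseteq> edges K"

definition graph_isomorphic :: "'u graph \<Rightarrow> 'v graph \<Rightarrow> bool" where
  "graph_isomorphic G H \<longleftrightarrow>
     (\<exists>f. bij_betw f (verts G) (verts H) \<and>
        (\<forall>u\<in>verts G. \<forall>v\<in>verts G. {u, v} \<in> edges G \<longleftrightarrow> {f u, f v} \<in> edges H))"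

datatype color = Red | Blue

(* Colorings are total functions on vertex sets; only their values on the edges
   of the complete graph are relevant. *)
definition ramsey_property :: "'v graph \<Rightarrow> nat \<Rightarrow> bool" where
  "ramsey_property G N \<longleftrightarrow>
     (\<forall>c :: nat set \<Rightarrow> color.
        \<exists>H k. subgraph H (complete_graph N) \<and> graph_isomorphic G H \<and>
              (\<forall>e\<in>edges H. c e = k))"

definition ramsey_number :: "'v graph \<Rightarrow> nat" where
  "ramsey_number G = (LEAST N. ramsey_property G N)"

(* By Ramsey's theorem the minimum is attained, so LEAST is not underspecified here. *)
lemma ramsey_property_ramsey_number:
  assumes "simple_graph G"
  shows "ramsey_property G (ramsey_number G)"
proof -
  let ?n = "card (verts G)"
  have fin: "finite (verts G)" and E: "edges G \<subseteq> nsets (verts G) 2"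
    using assms by (auto simp: simple_graph_def)
  obtain N :: nat where N: "partn_lst {..<N} [?n, ?n] 2"
    using ramsey2_full by blast
  have "ramsey_property G N"
    unfolding ramsey_property_def
  proof
    fix c :: "nat set \<Rightarrow> color"
    define f where "f e = (if c e = Red then 0 else 1 :: nat)" for e
    have "f \<in> nsets {..<N} 2 \<rightarrow> {..<2}"
      by (auto simp: f_def)
    with N obtain i W where i: "i < length [?n, ?n]" and W: "W \<in> nsets {..<N} ([?n, ?n] ! i)"
      and mono: "f ` nsets W 2 \<subseteq> {i}"
      by (rule partn_lstE) auto
    have "[?n, ?n] ! i = ?n"
      using i by (auto simp: less_Suc_eq nth_Cons')
    with W have W: "W \<subseteq> {..<N}" "finite W" "card W = ?n"
      by (auto simp: nsets_def)
    then obtain g where g: "bij_betw g (verts G) W"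
      using fin finite_same_card_bij by metis
    define H where "H = (W, (`) g ` edges G)"
    have sub: "edges H \<subseteq> nsets W 2"
      using E bij_betw_nsets[OF g, of 2] by (auto simp: H_def bij_betw_def)
    have "simple_graph H"
      using W sub by (simp add: simple_graph_def H_def)
    moreover have "nsets W 2 \<subseteq> nsets {..<N} 2"
      using W by (intro nsets_mono)
    ultimately have "subgraph H (complete_graph N)"
      using W sub by (auto simp: subgraph_def complete_graph_def H_def)
    moreover have "graph_isomorphic G H"
      unfolding graph_isomorphic_def
    proof (intro exI[of _ g] conjI ballI)
      show "bij_betw g (verts G) (verts H)"
        using g by (simp add: H_def)
      fix u v assume uv: "u \<in> verts G" "v \<in> verts G"
      have inj: "inj_on g (verts G)"
        using g by (simp add: bij_betw_def)
      have "{u, v} \<in> edges G" if "{g u, g v} \<in> edges H"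
      proof -
        obtain e where e: "e \<in> edges G" "g ` {u, v} = g ` e"
          using \<open>{g u, g v} \<in> edges H\<close> by (auto simp: H_def)
        moreover have "e \<subseteq> verts G"
          using e E by (auto simp: nsets_def)
        ultimately have "{u, v} = e"
          using inj_on_image_eq_iff[OF inj, of "{u, v}" e] uv by simp
        with e show ?thesis by simp
      qed
      moreover have "{g u, g v} \<in> edges H" if "{u, v} \<in> edges G"
        using imageI[OF that, of "(`) g"] by (simp add: H_def)
      ultimately show "{u, v} \<in> edges G \<longleftrightarrow> {g u, g v} \<in> edges H"
        by blast
    qed
    moreover have "\<forall>e\<in>edges H. c e = (if i = 0 then Red else Blue)"
    proof
      fix e assume "e \<in> edges H"
      then have "f e = i"
        using sub mono by blast
      then show "c e = (if i = 0 then Red else Blue)"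
        by (cases "c e") (auto simp: f_def)
    qed
    ultimately show "\<exists>H k. subgraph H (complete_graph N) \<and> graph_isomorphic G H \<and>
        (\<forall>e\<in>edges H. c e = k)"
      by blast
  qed
  then show ?thesis
    unfolding ramsey_number_def by (rule LeastI)
qed

end

theory Submission
  imports Defs
begin

text \<open>The argument is Sudakov's.  A two-colouring is a symmetric irreflexive relation \<open>R\<close> (one colour)
together with \<open>co R\<close> (the other).  The central notion is a monochromatic pair \<open>(X, Y)\<close>: all pairs
inside \<open>X\<close> and all pairs between \<open>X\<close> and \<open>Y\<close> have the same colour.  Such a pair can absorb any
\<open>card X\<close> vertices of \<open>G\<close> into \<open>X\<close>, and then only the rest of \<open>G\<close> has to be found in that colour
inside \<open>Y\<close>.  The best vertices to absorb are those of largest degree: since the degrees sum to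
\<open>2m\<close>, putting those of degree above \<open>2m/t\<close> into a set \<open>X\<close> of size \<open>t\<close> leaves a graph of
maximum degree at most \<open>2m/t\<close>.

With \<open>k = \<lceil>\<surd>m\<rceil>\<close>, the Erdos-Szekeres argument gives a first pair with \<open>card X = 32k\<close> at the price of a
factor \<open>2 ^ (64k)\<close> in the size of \<open>Y\<close> (\<open>erdos_szekeres_pair\<close>).  From then on \<open>X\<close> is doubled again
and again.  If the rest of \<open>G\<close>, of maximum degree \<open>d \<le> 2m/t\<close>, is not found in \<open>Y\<close> in the colour
of the pair, then \<open>Y\<close> has a large subset \<open>S\<close> in which this colour is very sparse
(\<open>sparse_subset_if_not_embeds\<close>), at a price of about \<open>d (log (1/\<epsilon>))\<^sup>2\<close> in the exponent for density \<open>\<epsilon>\<close>.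
Inside \<open>S\<close> the colouring is very unbalanced, and so \<open>S\<close> contains a monochromatic pair
with a much larger \<open>X\<close> than a general colouring would give (\<open>sparse_mono_pair\<close>): the exponent
pays only about \<open>\<epsilon> t' log (1/\<epsilon>)\<close> for \<open>card X \<ge> t'\<close>.  When \<open>t\<close> doubles in every round and \<open>\<epsilon>\<close> drops by
a factor of 4, both prices decrease geometrically, up to polynomial factors in the number of rounds.
Therefore all rounds together cost \<open>O(k)\<close> in the exponent, and the rounds can go on until \<open>X\<close>
has at least as many vertices as \<open>G\<close>, when \<open>G\<close> embeds into the clique \<open>X\<close>.  The constants are such that \<open>2 ^ (166k)\<close>
vertices suffice, and \<open>166k \<le> 250\<surd>m\<close>.\<close>

section \<open>Monochromatic pairs\<close>

definition co :: "('a \<Rightarrow> 'a \<Rightarrow> bool) \<Rightarrow> 'a \<Rightarrow> 'a \<Rightarrow> bool" where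
  "co R u v \<longleftrightarrow> u \<noteq> v \<and> \<not> R u v"

definition nbhd :: "('a \<Rightarrow> 'a \<Rightarrow> bool) \<Rightarrow> 'a \<Rightarrow> 'a set \<Rightarrow> 'a set" where
  "nbhd R v S = {u \<in> S. R v u}"

definition mono_pair :: "('a \<Rightarrow> 'a \<Rightarrow> bool) \<Rightarrow> 'a set \<Rightarrow> 'a set \<Rightarrow> bool" where
  "mono_pair R X Y \<longleftrightarrow> (\<forall>x\<in>X. \<forall>y\<in>X. x \<noteq> y \<longrightarrow> R x y) \<and> (\<forall>x\<in>X. \<forall>y\<in>Y. R x y)"

lemma nbhd_subset: "nbhd R v S \<subseteq> S"
  by (auto simp: nbhd_def)

lemma finite_nbhd: "finite S \<Longrightarrow> finite (nbhd R v S)"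
  by (simp add: nbhd_def)

lemma symp_co: "symp R \<Longrightarrow> symp (co R)"
  by (auto simp: symp_def co_def)

lemma irreflp_co: "irreflp (co R)"
  by (auto simp: irreflp_def co_def)

lemma co_co: "irreflp R \<Longrightarrow> co (co R) = R"
  by (auto simp: irreflp_def co_def fun_eq_iff)

lemma mono_pair_insert:
  assumes "symp R" "irreflp R" "mono_pair R X Y" "X \<subseteq> nbhd R v W" "Y \<subseteq> nbhd R v W"
  shows "mono_pair R (insert v X) Y" "v \<notin> X"
  using assms by (auto simp: mono_pair_def nbhd_def symp_def irreflp_def)

lemma card_nbhd_co:
  assumes "irreflp R" "finite W" "v \<in> W"
  shows "card (nbhd R v W) + card (nbhd (co R) v W) + 1 = card W"
proof -
  have "card W = card (insert v (nbhd R v W \<union> nbhd (co R) v W))"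
    using assms by (intro arg_cong[where f = card]) (auto simp: nbhd_def co_def)
  also have "\<dots> = Suc (card (nbhd R v W \<union> nbhd (co R) v W))"
    using assms by (intro card_insert_disjoint) (auto simp: nbhd_def co_def irreflp_def)
  also have "card (nbhd R v W \<union> nbhd (co R) v W) = card (nbhd R v W) + card (nbhd (co R) v W)"
    using assms by (intro card_Un_disjoint) (auto simp: nbhd_def co_def)
  finally show ?thesis by simp
qed

text \<open>The weights \<open>\<alpha>\<close> and \<open>\<beta>\<close> say what part of the current set must survive when the next vertex is put on
the first or on the second side.  Since \<open>\<alpha> + \<beta> = 1\<close>, at each vertex one of the two neighbourhoods is
large enough; the vertex itself, which belongs to neither, is paid for by the summands \<open>1\<close> in the
size condition.  The case \<open>\<alpha> = \<beta> = 1/2\<close> is the usual argument.  With \<open>\<beta>\<close> small, long cliques of the first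
colour become cheap as long as only short ones of the second are asked for.\<close>

lemma erdos_szekeres_pair:
  fixes \<alpha> \<beta> M :: real
  assumes R: "symp R" "irreflp R" and wt: "0 < \<alpha>" "0 < \<beta>" "\<alpha> + \<beta> = 1" and M: "0 \<le> M"
    and "finite W" "M + 1 \<le> (real (card W) + 1) * \<alpha> ^ a * \<beta> ^ b"
  shows "(\<exists>X Y. X \<subseteq> W \<and> Y \<subseteq> W \<and> mono_pair R X Y \<and> card X = a \<and> M \<le> real (card Y)) \<or>
         (\<exists>X Y. X \<subseteq> W \<and> Y \<subseteq> W \<and> mono_pair (co R) X Y \<and> card X = b \<and> M \<le> real (card Y))"
  using assms(7,8)
proof (induction "a + b" arbitrary: a b W rule: less_induct)
  case less
  have le1: "\<alpha> ^ i \<le> 1" "\<beta> ^ i \<le> 1" for i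
    using wt by (auto intro: power_le_one)
  have "(real (card W) + 1) * (\<alpha> ^ a * \<beta> ^ b) \<le> (real (card W) + 1) * 1"
    using le1 wt by (intro mult_left_mono mult_le_one) auto
  from order_trans[OF less.prems(2)[unfolded mult.assoc] this]
  have MW: "M \<le> real (card W)" by simp
  show ?case
  proof (cases "a = 0 \<or> b = 0")
    case True
    moreover have "mono_pair S {} W" for S by (simp add: mono_pair_def)
    ultimately show ?thesis
      using MW by (metis card.empty empty_subsetI subset_refl)
  next
    case False
    then obtain a' b' where ab: "a = Suc a'" "b = Suc b'"
      by (meson not0_implies_Suc)
    define w where "w = \<alpha> ^ a * \<beta> ^ b"
    have "w \<le> \<alpha> * 1"
      using le1[of a'] le1[of b] wt unfolding w_def ab
      by (intro mult_mono) (auto simp: mult_left_le)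
    then have "w < 1" using wt by simp
    have main: "M + 1 \<le> (real (card W) + 1) * w"
      using less.prems by (simp add: w_def mult.assoc)
    have "W \<noteq> {}"
      using main \<open>w < 1\<close> M by auto
    then obtain v where v: "v \<in> W" by blast
    define A where "A = nbhd R v W"
    define B where "B = nbhd (co R) v W"
    have sub: "A \<subseteq> W" "B \<subseteq> W" and fin: "finite A" "finite B"
      using \<open>finite W\<close> by (auto simp: A_def B_def finite_nbhd nbhd_def)
    have cW: "real (card W) = real (card A) + real (card B) + 1"
      using card_nbhd_co[OF R(2) \<open>finite W\<close> v] by (simp add: A_def B_def)
    have "M + 1 \<le> (real (card A) + 1) * \<alpha> ^ a' * \<beta> ^ b \<or>
          M + 1 \<le> (real (card B) + 1) * \<alpha> ^ a * \<beta> ^ b'"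
    proof (rule ccontr)
      assume "\<not> ?thesis"
      then have "\<alpha> * (M + 1) > \<alpha> * ((real (card A) + 1) * \<alpha> ^ a' * \<beta> ^ b)"
        "\<beta> * (M + 1) > \<beta> * ((real (card B) + 1) * \<alpha> ^ a * \<beta> ^ b')"
        using wt by auto
      then have "\<alpha> * (M + 1) > (real (card A) + 1) * w" "\<beta> * (M + 1) > (real (card B) + 1) * w"
        by (simp_all add: w_def ab mult_ac)
      then have "(\<alpha> + \<beta>) * (M + 1) > (real (card W) + 1) * w"
        unfolding cW by (simp add: algebra_simps)
      with main wt show False by simp
    qed
    then show ?thesis
    proof
      assume "M + 1 \<le> (real (card A) + 1) * \<alpha> ^ a' * \<beta> ^ b"
      from less.hyps[OF _ fin(1) this] ab consider
        (red) X Y where "X \<subseteq> A" "Y \<subseteq> A" "mono_pair R X Y" "card X = a'" "M \<le> real (card Y)" |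
        (blue) X Y where "X \<subseteq> A" "Y \<subseteq> A" "mono_pair (co R) X Y" "card X = b" "M \<le> real (card Y)"
        by auto
      then show ?thesis
      proof cases
        case red
        note ins = mono_pair_insert[OF R red(3), of v W]
        have "card (insert v X) = a"
          using ins(2) red fin ab by (simp add: A_def finite_subset)
        then show ?thesis
          using ins(1) red v sub
            by (intro disjI1 exI[of _ "insert v X"] exI[of _ Y]) (auto simp: A_def)
      next
        case blue
        then show ?thesis using sub by (intro disjI2 exI[of _ X] exI[of _ Y]) auto
      qed
    next
      assume "M + 1 \<le> (real (card B) + 1) * \<alpha> ^ a * \<beta> ^ b'"
      from less.hyps[OF _ fin(2) this] ab consider
        (red) X Y where "X \<subseteq> B" "Y \<subseteq> B" "mono_pair R X Y" "card X = a" "M \<le> real (card Y)" |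
        (blue) X Y where "X \<subseteq> B" "Y \<subseteq> B" "mono_pair (co R) X Y" "card X = b'" "M \<le> real (card Y)"
        by auto
      then show ?thesis
      proof cases
        case red
        then show ?thesis using sub by (intro disjI1 exI[of _ X] exI[of _ Y]) auto
      next
        case blue
        note ins = mono_pair_insert[OF symp_co[OF R(1)] irreflp_co blue(3), of v W]
        have "card (insert v X) = b"
          using ins(2) blue fin ab by (simp add: B_def finite_subset)
        then show ?thesis
          using ins(1) blue v sub
            by (intro disjI2 exI[of _ "insert v X"] exI[of _ Y]) (auto simp: B_def)
      qed
    qed
  qed
qed

section \<open>Monochromatic pairs in unbalanced colourings\<close>

lemma sum_card_nbhd_swap:
  assumes "symp R" "finite A" "finite B"
  shows "(\<Sum>u\<in>A. card (nbhd R u B)) = (\<Sum>v\<in>B. card (nbhd R v A))"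
proof (rule sum_multicount_gen[of A B "\<lambda>u v. R u v", folded nbhd_def])
  show "\<forall>v\<in>B. card {u \<in> A. R u v} = card (nbhd R v A)"
    using sympD[OF assms(1)] by (auto simp: nbhd_def intro!: arg_cong[where f = card])
qed (use assms in auto)

text \<open>Markov's inequality for counting.\<close>

lemma markov_card:
  fixes f :: "'a \<Rightarrow> real"
  assumes "finite A" "\<And>a. a \<in> A \<Longrightarrow> 0 \<le> f a"
  shows "real (card {a \<in> A. c < f a}) * c \<le> sum f A"
proof -
  have "real (card {a \<in> A. c < f a}) * c = (\<Sum>a\<in>{a \<in> A. c < f a}. c)" by simp
  also have "\<dots> \<le> (\<Sum>a\<in>{a \<in> A. c < f a}. f a)" by (intro sum_mono) auto
  also have "\<dots> \<le> sum f A" using assms by (intro sum_mono2) auto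
  finally show ?thesis .
qed

lemma sum_power_card_Pow:
  fixes x :: real
  assumes "finite I"
  shows "(\<Sum>D\<in>Pow I. x ^ card D) = (1 + x) ^ card I"
  using prod_add[OF assms, of "\<lambda>_. x" "\<lambda>_. 1"] by (simp add: add.commute[of x 1])

text \<open>Pigeonhole for the traces on \<open>I\<close>.  There are at most \<open>(1 + x) ^ card I / x ^ a\<close> sets \<open>D \<subseteq> I\<close>
with \<open>card D \<le> a\<close>, because \<open>(1 + x) ^ card I\<close> is the sum of \<open>x ^ card D\<close> over all \<open>D \<subseteq> I\<close>.\<close>

lemma popular_trace:
  fixes x :: real
  assumes "finite I" "finite Z" "0 < x" "x \<le> 1"
    and few: "\<And>y. y \<in> Z \<Longrightarrow> card (nbhd R y I) \<le> a"
  obtains D where "D \<subseteq> I" "card D \<le> a"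
    "x ^ a * real (card Z) \<le> (1 + x) ^ card I * real (card {y \<in> Z. nbhd R y I = D})"
proof -
  define F where "F = {D \<in> Pow I. card D \<le> a}"
  have F: "finite F" "{} \<in> F" "F \<subseteq> Pow I"
    using assms by (auto simp: F_def)
  let ?c = "\<lambda>D. real (card {y \<in> Z. nbhd R y I = D})"
  have "\<exists>D\<in>F. x ^ a * real (card Z) \<le> (1 + x) ^ card I * ?c D"
  proof (rule ccontr)
    assume no: "\<not> ?thesis"
    have "card Z = (\<Sum>D\<in>F. card {y \<in> Z. nbhd R y I = D})"
    proof -
      have "Z = (\<Union>D\<in>F. {y \<in> Z. nbhd R y I = D})"
        using few by (auto simp: F_def nbhd_def)
      then have "card Z = card (\<Union>D\<in>F. {y \<in> Z. nbhd R y I = D})" by simp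
      also have "\<dots> = (\<Sum>D\<in>F. card {y \<in> Z. nbhd R y I = D})"
        using F assms by (intro card_UN_disjoint) auto
      finally show ?thesis .
    qed
    then have "(1 + x) ^ card I * real (card Z) = (\<Sum>D\<in>F. (1 + x) ^ card I * ?c D)"
      by (simp add: sum_distrib_left)
    also have "\<dots> < (\<Sum>D\<in>F. x ^ card D * real (card Z))"
    proof (rule sum_strict_mono)
      fix D assume D: "D \<in> F"
      have "(1 + x) ^ card I * ?c D < x ^ a * real (card Z)" using no D by auto
      also have "\<dots> \<le> x ^ card D * real (card Z)"
        using D assms by (intro mult_right_mono power_decreasing) (auto simp: F_def)
      finally show "(1 + x) ^ card I * ?c D < x ^ card D * real (card Z)" .
    qed (use F in auto)
    also have "\<dots> = (\<Sum>D\<in>F. x ^ card D) * real (card Z)" by (simp add: sum_distrib_right)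
    also have "\<dots> \<le> (\<Sum>D\<in>Pow I. x ^ card D) * real (card Z)"
      using F assms by (intro mult_right_mono sum_mono2) auto
    also have "\<dots> = (1 + x) ^ card I * real (card Z)"
      using assms by (simp add: sum_power_card_Pow)
    finally show False by simp
  qed
  then show ?thesis using that by (auto simp: F_def)
qed

text \<open>The clique argument of Erdos and Szemeredi, for pairs.  Let \<open>U\<close> consist of the vertices of small
\<open>R\<close>-degree, at least half of \<open>S\<close>, and \<open>I\<close> a clique of \<open>co R\<close> in \<open>U\<close>, of the largest size among those of at most \<open>2t\<close> vertices.
A typical vertex has few \<open>R\<close>-neighbours in \<open>I\<close>, so many vertices \<open>Y\<close> of \<open>U\<close> share one
small trace \<open>D\<close> on \<open>I\<close>.  If \<open>I\<close> has \<open>2t\<close> vertices, then \<open>(I - D, Y)\<close> is the desired pair.  If \<open>I\<close> is smaller,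
then a clique of \<open>co R\<close> in \<open>Y\<close> with more than \<open>card D\<close> vertices could replace \<open>D\<close> in \<open>I\<close> and contradict
the choice of \<open>I\<close>.  So \<open>Y\<close> has only very small cliques of \<open>co R\<close>, and the weighted
Erdos-Szekeres argument yields a pair for \<open>R\<close>.  The number \<open>a\<close> is the integer part of \<open>2xt\<close>.\<close>

lemma sparse_mono_pair:
  fixes x M :: real
  assumes R: "symp R" "irreflp R" and "finite S" and x: "0 < x" "x \<le> 1 / 2" and M: "0 \<le> M"
    and sparse: "real (\<Sum>v\<in>S. card (nbhd R v S)) \<le> x / 8 * (real (card S))\<^sup>2"
    and a: "real a \<le> 2 * x * real t" "2 * x * real t < real a + 1"
    and t: "0 < t" "16 * t \<le> card S"
    and size: "8 * (M + 1) * (1 + x) ^ (3 * t + a + 1) \<le> real (card S) * x ^ (2 * a + 1)"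
  shows "\<exists>C X Y. C \<in> {R, co R} \<and> X \<subseteq> S \<and> Y \<subseteq> S \<and> mono_pair C X Y \<and> t \<le> card X \<and> M \<le> real (card Y)"
proof -
  define n where "n = real (card S)"
  have n: "0 < n" "16 * real t \<le> n" using t by (auto simp: n_def)
  define U where "U = {u \<in> S. real (card (nbhd R u S)) \<le> x / 4 * n}"
  have U: "U \<subseteq> S" "finite U" using \<open>finite S\<close> by (auto simp: U_def)
  have "n / 2 \<le> real (card U)"
  proof -
    have "real (card {u \<in> S. x / 4 * n < real (card (nbhd R u S))}) * (x / 4 * n) \<le> x / 8 * n\<^sup>2"
      by (rule order_trans[OF markov_card sparse[folded n_def, unfolded of_nat_sum]])
        (use \<open>finite S\<close> in auto)
    then have "real (card {u \<in> S. x / 4 * n < real (card (nbhd R u S))}) \<le> n / 2"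
      using n x by (simp add: power2_eq_square field_simps)
    moreover have "card S = card U + card {u \<in> S. x / 4 * n < real (card (nbhd R u S))}"
    proof -
      have "S = U \<union> {u \<in> S. x / 4 * n < real (card (nbhd R u S))}" by (auto simp: U_def)
      then have "card S = card (U \<union> {u \<in> S. x / 4 * n < real (card (nbhd R u S))})" by (rule arg_cong)
      also have "\<dots> = card U + card {u \<in> S. x / 4 * n < real (card (nbhd R u S))}"
        using \<open>finite S\<close> by (intro card_Un_disjoint) (auto simp: U_def)
      finally show ?thesis .
    qed
    ultimately show ?thesis unfolding n_def by linarith
  qed
  define cl where "cl I \<longleftrightarrow> I \<subseteq> U \<and> card I \<le> 2 * t \<and> (\<forall>u\<in>I. \<forall>v\<in>I. u \<noteq> v \<longrightarrow> co R u v)" for I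
  have "\<exists>I. cl I \<and> (\<forall>J. cl J \<longrightarrow> card J \<le> card I)"
    by (rule ex_has_greatest_nat[of _ "{}" _ "2 * t + 1"]) (auto simp: cl_def)
  then obtain I where I: "cl I" and max: "\<And>J. cl J \<Longrightarrow> card J \<le> card I" by blast
  have IU: "I \<subseteq> U" "finite I" "card I \<le> 2 * t"
    using I finite_subset[OF _ U(2)] by (simp_all add: cl_def)
  \<comment> \<open>\<open>I\<close> is removed because a vertex of \<open>I\<close> is in neither colour adjacent to itself.\<close>
  define Z where "Z = {y \<in> U. real (card (nbhd R y I)) \<le> 2 * x * real t} - I"
  have "finite Z" using U by (simp add: Z_def)
  have Z: "n / 8 \<le> real (card Z)"
  proof -
    have "(\<Sum>y\<in>U. real (card (nbhd R y I))) \<le> (\<Sum>y\<in>S. real (card (nbhd R y I)))"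
      using U \<open>finite S\<close> by (intro sum_mono2) auto
    also have "\<dots> = real (\<Sum>y\<in>S. card (nbhd R y I))" by simp
    also have "\<dots> = (\<Sum>u\<in>I. real (card (nbhd R u S)))"
      using sum_card_nbhd_swap[OF R(1) \<open>finite S\<close> IU(2)] by simp
    also have "\<dots> \<le> (\<Sum>u\<in>I. x / 4 * n)"
      using IU by (intro sum_mono) (auto simp: U_def)
    also have "\<dots> \<le> 2 * real t * (x / 4 * n)"
      using IU(3) x n by (simp add: mult_right_mono)
    finally have "real (card {y \<in> U. 2 * x * real t < real (card (nbhd R y I))}) * (2 * x * real t)
        \<le> 2 * real t * (x / 4 * n)"
      using markov_card[OF U(2), of "\<lambda>y. real (card (nbhd R y I))" "2 * x * real t"] by simp
    then have few: "real (card {y \<in> U. 2 * x * real t < real (card (nbhd R y I))}) \<le> n / 4"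
      using x t by (simp add: field_simps)
    have "U \<subseteq> (Z \<union> I) \<union> {y \<in> U. 2 * x * real t < real (card (nbhd R y I))}"
      by (auto simp: Z_def)
    then have "card U \<le> card ((Z \<union> I) \<union> {y \<in> U. 2 * x * real t < real (card (nbhd R y I))})"
      using U \<open>finite Z\<close> IU by (intro card_mono) auto
    also have "\<dots> \<le> card Z + card I + card {y \<in> U. 2 * x * real t < real (card (nbhd R y I))}"
      using card_Un_le[of "Z \<union> I" "{y \<in> U. 2 * x * real t < real (card (nbhd R y I))}"] card_Un_le[of Z I]
      by linarith
    finally have "real (card U) \<le> real (card Z) + real (card I)
        + real (card {y \<in> U. 2 * x * real t < real (card (nbhd R y I))})" by linarith
    moreover have "real (card I) \<le> n / 8"
      using IU(3) n by linarith
    ultimately show ?thesis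
      using few \<open>n / 2 \<le> real (card U)\<close> by linarith
  qed
  have "card (nbhd R y I) \<le> a" if "y \<in> Z" for y
    using that a by (auto simp: Z_def)
  then obtain D where D: "D \<subseteq> I" "card D \<le> a"
    and big: "x ^ a * real (card Z) \<le> (1 + x) ^ card I * real (card {y \<in> Z. nbhd R y I = D})"
    using popular_trace[OF IU(2) \<open>finite Z\<close>, of x R a] x by auto
  define Y where "Y = {y \<in> Z. nbhd R y I = D}"
  have "finite Y" using \<open>finite Z\<close> by (simp add: Y_def)
  then have Y: "Y \<subseteq> U" "finite Y" "Y \<inter> I = {}"
    by (auto simp: Y_def Z_def)
  have cross: "co R u y" if "u \<in> I - D" "y \<in> Y" for u y
    using that Y R by (auto simp: co_def Y_def nbhd_def dest: sympD)
  have key: "(M + 1) * (1 + x) ^ (t + a + 1) \<le> real (card Y) * x ^ (a + 1)"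
  proof -
    have "(1 + x) ^ (2 * t) * ((M + 1) * (1 + x) ^ (t + a + 1)) = (M + 1) * (1 + x) ^ (3 * t + a + 1)"
      by (simp add: power_add[symmetric] mult_ac)
    also have "\<dots> \<le> n * x ^ (2 * a + 1) / 8" using size unfolding n_def by linarith
    also have "\<dots> = (n / 8 * x ^ a) * x ^ (a + 1)" by (simp add: mult_2 power_add)
    also have "\<dots> \<le> (real (card Z) * x ^ a) * x ^ (a + 1)"
      using Z x by (intro mult_right_mono) auto
    also have "\<dots> \<le> ((1 + x) ^ card I * real (card Y)) * x ^ (a + 1)"
      using big x by (intro mult_right_mono) (auto simp: Y_def mult.commute)
    also have "\<dots> \<le> ((1 + x) ^ (2 * t) * real (card Y)) * x ^ (a + 1)"
      using x IU by (intro mult_right_mono power_increasing) auto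
    finally have "(1 + x) ^ (2 * t) * ((M + 1) * (1 + x) ^ (t + a + 1))
        \<le> (1 + x) ^ (2 * t) * (real (card Y) * x ^ (a + 1))" by (simp add: mult_ac)
    then show ?thesis using x by (simp add: mult_le_cancel_left_pos)
  qed
  show ?thesis
  proof (cases "card I = 2 * t")
    case True
    have "2 * x * real t \<le> 1 * real t" using x by (intro mult_right_mono) auto
    then have "a \<le> t" using a by linarith
    then have "t \<le> card (I - D)"
      using True D finite_subset[OF D(1) IU(2)] by (subst card_Diff_subset) auto
    moreover have "mono_pair (co R) (I - D) Y"
      using I cross by (auto simp: mono_pair_def cl_def)
    moreover have "M \<le> real (card Y)"
    proof -
      have "(M + 1) * 1 \<le> (M + 1) * (1 + x) ^ (t + a + 1)"
        using M x by (intro mult_left_mono one_le_power) auto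
      also note key
      also have "real (card Y) * x ^ (a + 1) \<le> real (card Y) * 1"
        using x by (intro mult_left_mono power_le_one) auto
      finally show ?thesis by simp
    qed
    moreover have "I - D \<subseteq> S" "Y \<subseteq> S" using IU U Y by auto
    ultimately show ?thesis by (intro exI[of _ "co R"] exI[of _ "I - D"] exI[of _ Y]) auto
  next
    case False
    \<comment> \<open>The ratio \<open>\<beta>/\<alpha> = x\<close> reflects that at most about \<open>2xt\<close> vertices are wanted for \<open>co R\<close>, but \<open>t\<close> for \<open>R\<close>.\<close>
    define \<alpha> where "\<alpha> = 1 / (1 + x)"
    define \<beta> where "\<beta> = x / (1 + x)"
    have wt: "0 < \<alpha>" "0 < \<beta>" "\<alpha> + \<beta> = 1" "\<beta> \<le> 1"
      using x by (auto simp: \<alpha>_def \<beta>_def add_divide_distrib[symmetric])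
    have "M + 1 \<le> real (card Y) * x ^ (a + 1) / (1 + x) ^ (t + a + 1)"
      using key x by (simp add: pos_le_divide_eq)
    also have "\<dots> = real (card Y) * \<alpha> ^ t * \<beta> ^ (a + 1)"
      by (simp add: \<alpha>_def \<beta>_def power_divide power_add)
    also have "\<dots> \<le> (real (card Y) + 1) * \<alpha> ^ t * \<beta> ^ (card D + 1)"
      using wt D by (intro mult_mono power_decreasing) auto
    finally have "M + 1 \<le> (real (card Y) + 1) * \<alpha> ^ t * \<beta> ^ (card D + 1)" .
    from erdos_szekeres_pair[OF R wt(1,2,3) M Y(2) this]
    consider (red) X Y' where "X \<subseteq> Y" "Y' \<subseteq> Y" "mono_pair R X Y'" "card X = t" "M \<le> real (card Y')"
      | (blue) J Y' where "J \<subseteq> Y" "mono_pair (co R) J Y'" "card J = card D + 1"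
      by (elim disjE exE conjE) auto
    then show ?thesis
    proof cases
      case red
      then have "X \<subseteq> S" "Y' \<subseteq> S" using Y U by auto
      with red show ?thesis by (intro exI[of _ R] exI[of _ X] exI[of _ Y']) auto
    next
      case blue
      have "finite J" using finite_subset[OF blue(1) Y(2)] .
      have "card D \<le> card I" using D IU by (simp add: card_mono)
      have "card ((I - D) \<union> J) = card (I - D) + card J"
        using Y blue IU \<open>finite J\<close> by (intro card_Un_disjoint) auto
      also have "\<dots> = card I + 1"
        using D finite_subset[OF D(1) IU(2)] blue \<open>card D \<le> card I\<close>
        by (subst card_Diff_subset) auto
      finally have c: "card ((I - D) \<union> J) = card I + 1" .
      have "co R u v" if "u \<in> (I - D) \<union> J" "v \<in> (I - D) \<union> J" "u \<noteq> v" for u v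
      proof -
        have "co R u v" if "u \<in> I" "v \<in> I" "u \<noteq> v" for u v using I that by (auto simp: cl_def)
        moreover have "co R u v" if "u \<in> J" "v \<in> J" "u \<noteq> v" for u v
          using blue(2) that by (auto simp: mono_pair_def)
        moreover have "co R u v" "co R v u" if "u \<in> I - D" "v \<in> J" for u v
          using cross[OF that(1), of v] that(2) blue(1) sympD[OF symp_co[OF R(1)]] by auto
        ultimately show ?thesis using that by blast
      qed
      moreover have "(I - D) \<union> J \<subseteq> U" using IU Y blue by auto
      ultimately have "cl ((I - D) \<union> J)"
        using c False IU by (auto simp: cl_def)
      from max[OF this] c show ?thesis by simp
    qed
  qed
qed

section \<open>Sparse subsets of hosts without a copy\<close>

definition embeds :: "'v set \<Rightarrow> ('v \<Rightarrow> 'v \<Rightarrow> bool) \<Rightarrow> ('a \<Rightarrow> 'a \<Rightarrow> bool) \<Rightarrow> 'a set \<Rightarrow> bool" where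
  "embeds V E R W \<longleftrightarrow> (\<exists>f. inj_on f V \<and> f ` V \<subseteq> W \<and> (\<forall>u\<in>V. \<forall>v\<in>V. E u v \<longrightarrow> R (f u) (f v)))"

lemma embeds_mono: "embeds V E R W \<Longrightarrow> W \<subseteq> W' \<Longrightarrow> embeds V E R W'"
  unfolding embeds_def by (meson order_trans)

text \<open>The vertices of \<open>V\<close> are embedded one at a time.  For every vertex \<open>v\<close> that is still to come, let \<open>C f F v\<close> be the
set of places compatible with the neighbours embedded so far.  As long as each embedded neighbour keeps
at least the fraction \<open>e\<close> of this set, its size never drops below \<open>e ^ d * card W\<close>.  By the hypothesis \<open>few\<close>,
for each of the at most \<open>d\<close> later neighbours at most \<open>A\<close> places violate this, so a good free place exists.\<close>

lemma greedy_embedding: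
  fixes e A :: real
  assumes E: "symp E" "irreflp E" and R: "symp R" and fin: "finite V" "finite W"
    and e: "0 < e" "e \<le> 1" and A: "0 \<le> A"
    and deg: "\<And>v. v \<in> V \<Longrightarrow> card (nbhd E v V) \<le> d"
    and few: "\<And>B. B \<subseteq> W \<Longrightarrow> e ^ d * real (card W) \<le> real (card B) \<Longrightarrow>
      real (card {w \<in> W. real (card (nbhd R w B)) < e * real (card B)}) \<le> A"
    and size: "real (card V) + real d * A \<le> e ^ d * real (card W)"
  shows "embeds V E R W"
proof -
  define C where "C f F v = {w \<in> W. \<forall>u\<in>F. E v u \<longrightarrow> R (f u) w}" for f F v
  have "\<exists>f. inj_on f F \<and> f ` F \<subseteq> W \<and> (\<forall>u\<in>F. \<forall>v\<in>F. E u v \<longrightarrow> R (f u) (f v)) \<and>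
      (\<forall>v\<in>V - F. e ^ card (nbhd E v F) * real (card W) \<le> real (card (C f F v)))"
    if "finite F" "F \<subseteq> V" for F
    using that
  proof induction
    case empty
    show ?case by (auto simp: nbhd_def C_def)
  next
    case (insert v F)
    then obtain f where f: "inj_on f F" "f ` F \<subseteq> W" "\<forall>u\<in>F. \<forall>v\<in>F. E u v \<longrightarrow> R (f u) (f v)"
      and Cf: "\<And>v. v \<in> V - F \<Longrightarrow> e ^ card (nbhd E v F) * real (card W) \<le> real (card (C f F v))"
      by auto
    have FV: "F \<subset> V" "finite F" using insert by auto
    have Cbig: "e ^ d * real (card W) \<le> real (card (C f F u))" if "u \<in> V - F" for u
    proof -
      have "card (nbhd E u F) \<le> card (nbhd E u V)"
        using FV fin by (intro card_mono) (auto simp: nbhd_def)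
      with deg[of u] that have "card (nbhd E u F) \<le> d" by auto
      then have "e ^ d * real (card W) \<le> e ^ card (nbhd E u F) * real (card W)"
        using e by (intro mult_right_mono power_decreasing) auto
      with Cf[OF that] show ?thesis by linarith
    qed
    \<comment> \<open>A place in \<open>bad u\<close> would shrink the set of places for \<open>u\<close> too much.\<close>
    define bad where "bad u = {w \<in> W. real (card (nbhd R w (C f F u))) < e * real (card (C f F u))}" for u
    define N where "N = nbhd E v (V - F)"
    have "finite N" using fin by (auto simp: N_def finite_nbhd)
    have "card N \<le> card (nbhd E v V)"
      using fin by (intro card_mono) (auto simp: N_def nbhd_def)
    then have "card N \<le> d" using deg[of v] insert.prems by simp
    have "real (card (\<Union>u\<in>N. bad u)) \<le> (\<Sum>u\<in>N. real (card (bad u)))"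
      using card_UN_le[OF \<open>finite N\<close>, of bad] unfolding of_nat_sum[symmetric] of_nat_le_iff .
    also have "\<dots> \<le> (\<Sum>u\<in>N. A)"
      unfolding bad_def by (intro sum_mono few Cbig) (auto simp: N_def nbhd_def C_def)
    also have "\<dots> \<le> real d * A" using \<open>card N \<le> d\<close> A by (simp add: mult_right_mono)
    finally have "real (card ((\<Union>u\<in>N. bad u) \<union> f ` F)) \<le> real d * A + real (card F)"
      using card_Un_le[of "\<Union>u\<in>N. bad u" "f ` F"] card_image_le[OF FV(2), of f] by linarith
    also have "\<dots> < real d * A + real (card V)"
      using psubset_card_mono[OF fin(1) FV(1)] by linarith
    also have "\<dots> \<le> real (card (C f F v))"
      using size Cbig[of v] insert.hyps insert.prems by auto
    finally have "card ((\<Union>u\<in>N. bad u) \<union> f ` F) < card (C f F v)" by simp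
    then have "\<not> C f F v \<subseteq> (\<Union>u\<in>N. bad u) \<union> f ` F"
      using card_mono[of "(\<Union>u\<in>N. bad u) \<union> f ` F" "C f F v"] FV \<open>finite N\<close> fin
      by (auto simp: bad_def)
    then obtain w where w: "w \<in> C f F v" "w \<notin> f ` F" "\<And>u. u \<in> N \<Longrightarrow> w \<notin> bad u"
      by blast
    have wW: "w \<in> W" using w by (simp add: C_def)
    define g where "g = f(v := w)"
    have gF: "g u = f u" if "u \<in> F" for u using that insert by (auto simp: g_def)
    have gv: "g v = w" by (simp add: g_def)
    have "inj_on g (insert v F)"
      using f(1) w(2) insert by (auto simp: inj_on_def g_def)
    moreover have "g ` insert v F \<subseteq> W" using f(2) wW by (auto simp: g_def)
    moreover have "R (g u) (g u')" if "u \<in> insert v F" "u' \<in> insert v F" "E u u'" for u u'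
    proof -
      have nv: "\<not> E v v" using E by (auto simp: irreflp_def)
      have wR: "R (f u) w" if "u \<in> F" "E v u" for u using w that by (auto simp: C_def)
      show ?thesis
      proof (cases "u = v")
        case True
        then have "u' \<in> F" "E v u'" using that nv by auto
        then show ?thesis using True gv gF sympD[OF R wR] by simp
      next
        case False
        then have u: "u \<in> F" using that by simp
        show ?thesis
        proof (cases "u' = v")
          case True
          then show ?thesis using u gv gF wR[OF u] sympD[OF E(1)] that(3) by simp
        next
          case False
          then show ?thesis using u gF f(3) that by simp
        qed
      qed
    qed
    moreover have "e ^ card (nbhd E u (insert v F)) * real (card W) \<le> real (card (C g (insert v F) u))"
      if u: "u \<in> V - insert v F" for u
    proof (cases "E u v")
      case True
      then have "E v u" using E by (auto dest: sympD)
      then have "u \<in> N" using u by (auto simp: N_def nbhd_def)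
      then have "e * real (card (C f F u)) \<le> real (card (nbhd R w (C f F u)))"
        using w(3)[of u] wW by (simp add: bad_def not_less)
      moreover have "nbhd R w (C f F u) = C g (insert v F) u"
        using True gF gv by (auto simp: nbhd_def C_def)
      moreover have "nbhd E u (insert v F) = insert v (nbhd E u F)" "v \<notin> nbhd E u F"
        using True insert by (auto simp: nbhd_def)
      moreover have "e * (e ^ card (nbhd E u F) * real (card W)) \<le> e * real (card (C f F u))"
        using Cf[of u] u e by (intro mult_left_mono) auto
      ultimately show ?thesis using FV by (simp add: finite_nbhd mult.assoc)
    next
      case False
      then have "nbhd E u (insert v F) = nbhd E u F" "C g (insert v F) u = C f F u"
        using gF by (auto simp: nbhd_def C_def)
      then show ?thesis using Cf[of u] u by auto
    qed
    ultimately show ?case by blast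
  qed
  from this[OF fin(1) order_refl] show ?thesis unfolding embeds_def by blast
qed

text \<open>If \<open>E\<close> does not embed, \<open>greedy_embedding\<close> fails, and this gives \<open>B\<close> and a large set of vertices each of which
is adjacent to few vertices of \<open>B\<close>.  In this large set a sparse \<open>S1\<close> is found by induction.  Most
vertices of \<open>B\<close> are adjacent to few vertices of \<open>S1\<close>, and among those a sparse \<open>S2\<close> is found by induction.
In \<open>S1 \<union> S2\<close> the pairs inside the two halves make up only half of all pairs, and the pairs across
are sparse, so each step halves the density up to a term of order \<open>e\<close>.  Fixing the exact size
\<open>2 ^ h * q\<close> makes the two halves equally large.  The density is counted with ordered pairs.\<close>

lemma sparse_subset_if_not_embeds:
  fixes e :: real
  assumes E: "symp E" "irreflp E" and R: "symp R" and fin: "finite V" "finite W"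
    and e: "0 < e" "e \<le> 1"
    and deg: "\<And>v. v \<in> V \<Longrightarrow> card (nbhd E v V) \<le> d"
    and q: "card V \<le> q" "0 < q"
    and "\<not> embeds V E R W"
    and "2 ^ (h + 1) * (2 / e) ^ (d * h) * real q \<le> real (card W)"
  shows "\<exists>S\<subseteq>W. card S = 2 ^ h * q \<and>
    real (\<Sum>v\<in>S. card (nbhd R v S)) \<le> (1 / 2 ^ h + 4 * e) * (real (card S))\<^sup>2"
  using assms(5,11,12)
proof (induction h arbitrary: W)
  case 0
  then have "q \<le> card W" by simp
  then obtain S where S: "S \<subseteq> W" "card S = q" "finite S"
    by (rule obtain_subset_with_card_n)
  have "(\<Sum>v\<in>S. card (nbhd R v S)) \<le> (\<Sum>v\<in>S. card S)"
    using S by (intro sum_mono card_mono nbhd_subset) auto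
  also have "\<dots> = (card S)\<^sup>2" by (simp add: power2_eq_square)
  finally have "real (\<Sum>v\<in>S. card (nbhd R v S)) \<le> real ((card S)\<^sup>2)"
    by (rule of_nat_mono)
  also have "\<dots> = 1 * (real (card S))\<^sup>2" by simp
  also have "\<dots> \<le> (1 / 2 ^ 0 + 4 * e) * (real (card S))\<^sup>2"
    using e by (intro mult_right_mono) auto
  finally show ?case using S by (intro exI[of _ S]) auto
next
  case (Suc h)
  define s where "s = 2 ^ h * q"
  define Mh where "Mh = 2 ^ (h + 1) * (2 / e) ^ (d * h) * real q"
  define n where "n = real (card W)"
  have "0 < s" using q by (simp add: s_def)
  have "1 \<le> (2 / e) ^ (d * h)" using e by (intro one_le_power) (auto simp: field_simps)
  then have "2 * real s * 1 \<le> 2 * real s * (2 / e) ^ (d * h)"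
    by (intro mult_left_mono) auto
  then have Ms: "2 * real s \<le> Mh" by (simp add: Mh_def s_def mult_ac)
  have "real q \<le> real s" using mult_right_mono[of 1 "2 ^ h" "real q"] by (simp add: s_def)
  have nM: "2 * Mh \<le> (e / 2) ^ d * n"
  proof -
    have "2 * Mh = (e / 2) ^ d * (2 ^ (Suc h + 1) * (2 / e) ^ (d * Suc h) * real q)"
      using e by (simp add: Mh_def power_add field_simps)
    also have "\<dots> \<le> (e / 2) ^ d * n"
      using Suc.prems e unfolding n_def by (intro mult_left_mono) auto
    finally show ?thesis .
  qed
  have mono: "(e / 2) ^ d * n \<le> e ^ d * n"
    using e by (intro mult_right_mono power_mono) (auto simp: n_def)
  have IH: "\<exists>S\<subseteq>T. card S = s \<and>
      real (\<Sum>v\<in>S. card (nbhd R v S)) \<le> (1 / 2 ^ h + 4 * e) * (real (card S))\<^sup>2"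
    if "T \<subseteq> W" "Mh \<le> real (card T)" for T
    using Suc.IH[of T] that Suc.prems embeds_mono[OF _ that(1)] finite_subset[OF that(1)]
    unfolding s_def Mh_def by blast
  \<comment> \<open>The factor \<open>2 ^ d\<close> in the denominator outweighs the factor \<open>d\<close> of the union bound.\<close>
  define A where "A = (e / 2) ^ d * n / 2"
  have "0 \<le> A" using e by (simp add: A_def n_def)
  have "real d * A \<le> 2 ^ d * A"
    using \<open>0 \<le> A\<close> of_nat_less_two_power[of d] by (intro mult_right_mono) (auto intro: less_imp_le)
  then have dA: "real d * A \<le> e ^ d * n / 2"
    by (simp add: A_def power_divide)
  have "real (card V) + real d * A \<le> e ^ d * real (card W)"
    using dA q \<open>real q \<le> real s\<close> Ms nM mono unfolding n_def by linarith
  then obtain B where B: "B \<subseteq> W" "e ^ d * n \<le> real (card B)"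
    and Abig: "A < real (card {w \<in> W. real (card (nbhd R w B)) < e * real (card B)})"
    using greedy_embedding[OF E R fin(1) Suc.prems(1) e \<open>0 \<le> A\<close> deg] Suc.prems(2)
    unfolding n_def by (meson not_le)
  have "finite B" using B Suc.prems finite_subset by blast
  obtain S1 where S1: "S1 \<subseteq> {w \<in> W. real (card (nbhd R w B)) < e * real (card B)}" "card S1 = s"
    and e1: "real (\<Sum>v\<in>S1. card (nbhd R v S1)) \<le> (1 / 2 ^ h + 4 * e) * (real (card S1))\<^sup>2"
    using IH[of "{w \<in> W. real (card (nbhd R w B)) < e * real (card B)}"] Abig nM
    unfolding A_def by force
  have "finite S1" using S1 \<open>0 < s\<close> by (metis card.infinite less_irrefl)
  define B0 where "B0 = {b \<in> B. real (card (nbhd R b S1)) \<le> 4 * e * real s} - S1"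
  have B0: "Mh \<le> real (card B0)"
  proof -
    have "(\<Sum>b\<in>B. real (card (nbhd R b S1))) = (\<Sum>w\<in>S1. real (card (nbhd R w B)))"
      using arg_cong[OF sum_card_nbhd_swap[OF R \<open>finite B\<close> \<open>finite S1\<close>], of real]
      by (simp only: of_nat_sum)
    also have "\<dots> \<le> (\<Sum>w\<in>S1. e * real (card B))"
      using S1 by (intro sum_mono) auto
    also have "\<dots> = real s * (e * real (card B))" using S1 by simp
    finally have "real (card {b \<in> B. 4 * e * real s < real (card (nbhd R b S1))}) * (4 * e * real s)
        \<le> real s * (e * real (card B))"
      using markov_card[OF \<open>finite B\<close>, of "\<lambda>b. real (card (nbhd R b S1))" "4 * e * real s"]
      by simp
    then have few: "real (card {b \<in> B. 4 * e * real s < real (card (nbhd R b S1))}) \<le> real (card B) / 4"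
      using e \<open>0 < s\<close> by (simp add: field_simps)
    have "B \<subseteq> (B0 \<union> S1) \<union> {b \<in> B. 4 * e * real s < real (card (nbhd R b S1))}"
      by (auto simp: B0_def)
    then have "card B \<le> card ((B0 \<union> S1) \<union> {b \<in> B. 4 * e * real s < real (card (nbhd R b S1))})"
      using \<open>finite B\<close> \<open>finite S1\<close> by (intro card_mono) (auto simp: B0_def)
    then have "card B \<le> card B0 + card S1 + card {b \<in> B. 4 * e * real s < real (card (nbhd R b S1))}"
      using card_Un_le[of "B0 \<union> S1" "{b \<in> B. 4 * e * real s < real (card (nbhd R b S1))}"]
        card_Un_le[of B0 S1] by linarith
    then have "real (card B) \<le> real (card B0) + real s + real (card B) / 4"
      using few S1 by linarith
    then show ?thesis using Ms nM mono B by linarith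
  qed
  have B0W: "B0 \<subseteq> W" using B by (auto simp: B0_def)
  obtain S2 where S2: "S2 \<subseteq> B0" "card S2 = s"
    and e2: "real (\<Sum>v\<in>S2. card (nbhd R v S2)) \<le> (1 / 2 ^ h + 4 * e) * (real (card S2))\<^sup>2"
    using IH[OF B0W B0] by blast
  have "finite S2" using S2 \<open>0 < s\<close> by (metis card.infinite less_irrefl)
  have disj: "S1 \<inter> S2 = {}" using S2 by (auto simp: B0_def)
  have cS: "card (S1 \<union> S2) = 2 * s"
    using S1 S2 disj \<open>finite S1\<close> \<open>finite S2\<close> by (simp add: card_Un_disjoint)
  have split: "card (nbhd R v (S1 \<union> S2)) = card (nbhd R v S1) + card (nbhd R v S2)" for v
  proof -
    have "nbhd R v (S1 \<union> S2) = nbhd R v S1 \<union> nbhd R v S2" by (auto simp: nbhd_def)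
    then show ?thesis
      using disj \<open>finite S1\<close> \<open>finite S2\<close> by (simp add: card_Un_disjoint finite_nbhd nbhd_def disjoint_iff)
  qed
  have cross: "(\<Sum>v\<in>S2. card (nbhd R v S1)) \<le> 4 * e * real s * real s"
  proof -
    have "(\<Sum>v\<in>S2. real (card (nbhd R v S1))) \<le> (\<Sum>v\<in>S2. 4 * e * real s)"
      using S2 by (intro sum_mono) (auto simp: B0_def)
    then show ?thesis using S2 by (simp add: mult_ac)
  qed
  have "(\<Sum>v\<in>S1 \<union> S2. card (nbhd R v (S1 \<union> S2))) =
      (\<Sum>v\<in>S1. card (nbhd R v S1)) + (\<Sum>v\<in>S1. card (nbhd R v S2)) +
      ((\<Sum>v\<in>S2. card (nbhd R v S1)) + (\<Sum>v\<in>S2. card (nbhd R v S2)))"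
    using disj \<open>finite S1\<close> \<open>finite S2\<close>
    by (simp add: sum.union_disjoint split sum.distrib)
  also have "(\<Sum>v\<in>S1. card (nbhd R v S2)) = (\<Sum>v\<in>S2. card (nbhd R v S1))"
    by (rule sum_card_nbhd_swap[OF R \<open>finite S1\<close> \<open>finite S2\<close>])
  finally have "real (\<Sum>v\<in>S1 \<union> S2. card (nbhd R v (S1 \<union> S2))) \<le>
      2 * ((1 / 2 ^ h + 4 * e) * (real s)\<^sup>2) + 2 * (4 * e * real s * real s)"
    using e1 e2 cross S1 S2 by simp
  also have "\<dots> = (1 / 2 ^ Suc h + 4 * e) * (real (card (S1 \<union> S2)))\<^sup>2"
    unfolding cS by (simp add: power2_eq_square algebra_simps)
  finally show ?case
    using S1 S2 B0W cS by (intro exI[of _ "S1 \<union> S2"]) (auto simp: s_def)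
qed

section \<open>Enlarging a monochromatic pair\<close>

text \<open>\<open>T\<close> goes into the clique \<open>X\<close>, in any way at all, and the rest into \<open>Y\<close>.\<close>

lemma embeds_mono_pair:
  assumes "irreflp R" "mono_pair R X Y" "finite X" "finite T" "card T \<le> card X" "symp E" "irreflp E" "symp R"
    and "embeds (V - T) E R Y"
  shows "embeds V E R (X \<union> Y)"
proof -
  obtain f where f: "inj_on f (V - T)" "f ` (V - T) \<subseteq> Y"
    "\<And>u v. u \<in> V - T \<Longrightarrow> v \<in> V - T \<Longrightarrow> E u v \<Longrightarrow> R (f u) (f v)"
    using assms unfolding embeds_def by auto
  obtain g where g: "g ` T \<subseteq> X" "inj_on g T"
    using card_le_inj[OF assms(4,3,5)] by auto
  have X: "\<And>x y. x \<in> X \<Longrightarrow> y \<in> X \<Longrightarrow> x \<noteq> y \<Longrightarrow> R x y" "\<And>x y. x \<in> X \<Longrightarrow> y \<in> Y \<Longrightarrow> R x y"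
    using assms(2) by (auto simp: mono_pair_def)
  have "X \<inter> Y = {}" using X(2) assms(1) by (auto simp: irreflp_def)
  define F where "F v = (if v \<in> T then g v else f v)" for v
  have FT: "F v \<in> X" if "v \<in> T" for v using that g by (auto simp: F_def)
  have FY: "F v \<in> Y" if "v \<in> V - T" for v using that f(2) by (auto simp: F_def)
  have inj: "inj_on F V"
  proof (rule inj_onI)
    fix u v assume uv: "u \<in> V" "v \<in> V" "F u = F v"
    then have "u \<in> T \<longleftrightarrow> v \<in> T" using FT FY \<open>X \<inter> Y = {}\<close> by (metis DiffI disjoint_iff)
    then show "u = v"
      using uv f(1) g(2) by (auto simp: F_def inj_on_def split: if_splits)
  qed
  moreover have "F ` V \<subseteq> X \<union> Y" using FT FY by auto
  moreover have "R (F u) (F v)" if uv: "u \<in> V" "v \<in> V" "E u v" for u v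
  proof -
    have "F u \<noteq> F v" using inj uv assms(7) by (auto simp: inj_on_def irreflp_def)
    show ?thesis
    proof (cases "u \<in> T")
      case True
      then show ?thesis using FT[OF True] FT[of v] FY[of v] X \<open>F u \<noteq> F v\<close> uv by (cases "v \<in> T") auto
    next
      case False
      show ?thesis
      proof (cases "v \<in> T")
        case True
        then show ?thesis using FT[of v] FY[of u] X False uv sympD[OF assms(8)] by auto
      next
        case F: False
        then show ?thesis using False f(3) uv by (simp add: F_def)
      qed
    qed
  qed
  ultimately show ?thesis unfolding embeds_def by (intro exI[of _ F]) auto
qed

text \<open>One round.  The vertices \<open>T\<close> of degree above \<open>d\<close> number fewer than \<open>t\<close>, since the degree sum is below
\<open>(d + 1) * t\<close>.  Hence they fit into \<open>X\<close>, and the remaining graph, of maximum degree at most \<open>d\<close>, does not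
embed into \<open>Y\<close> in the colour \<open>R\<close>.  The choices \<open>h = L + 4\<close> and \<open>e = 2 ^ -(L + 6)\<close> make \<open>R\<close> so sparse on a
subset of \<open>Y\<close> that \<open>sparse_mono_pair\<close> applies with \<open>x = 2 ^ -L\<close>.\<close>

lemma mono_pair_step:
  fixes M :: real
  assumes E: "symp E" "irreflp E" and R: "symp R" "irreflp R"
    and fin: "finite V" "finite X" "finite Y"
    and XY: "mono_pair R X Y" "t \<le> card X" and no: "\<not> embeds V E R (X \<union> Y)"
    and deg: "(\<Sum>v\<in>V. card (nbhd E v V)) < (d + 1) * t"
    and q: "card V \<le> q" "0 < q" "16 * t' \<le> q"
    and Y: "2 ^ (L + 5) * (2 ^ (L + 7)) ^ (d * (L + 4)) * real q \<le> real (card Y)"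
    and L: "0 < L" and t': "0 < t'" and M: "0 \<le> M"
    and a: "real a \<le> 2 * (1 / 2 ^ L) * real t'" "2 * (1 / 2 ^ L) * real t' < real a + 1"
    and size: "8 * (M + 1) * (1 + 1 / 2 ^ L) ^ (3 * t' + a + 1) \<le> real q * (1 / 2 ^ L) ^ (2 * a + 1)"
  shows "\<exists>C X' Y'. C \<in> {R, co R} \<and> X' \<subseteq> Y \<and> Y' \<subseteq> Y \<and> mono_pair C X' Y' \<and> t' \<le> card X' \<and> M \<le> real (card Y')"
proof -
  define T where "T = {v \<in> V. d < card (nbhd E v V)}"
  have T: "finite T" using fin by (simp add: T_def)
  have "card T * (d + 1) = (\<Sum>v\<in>T. d + 1)" by simp
  also have "\<dots> \<le> (\<Sum>v\<in>T. card (nbhd E v V))" by (intro sum_mono) (auto simp: T_def)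
  also have "\<dots> \<le> (\<Sum>v\<in>V. card (nbhd E v V))" using fin by (intro sum_mono2) (auto simp: T_def)
  finally have "card T * (d + 1) < (d + 1) * t" using deg by linarith
  then have "(d + 1) * card T < (d + 1) * t" by (simp only: mult.commute)
  then have "card T < t" by (simp only: mult_less_cancel1)
  then have "card T \<le> card X" using XY(2) by simp
  then have no': "\<not> embeds (V - T) E R Y"
    using embeds_mono_pair[OF R(2) XY(1) fin(2) T _ E R(1)] no by blast
  have deg': "card (nbhd E v (V - T)) \<le> d" if "v \<in> V - T" for v
  proof -
    have "card (nbhd E v (V - T)) \<le> card (nbhd E v V)"
      using fin by (intro card_mono) (auto simp: nbhd_def)
    with that show ?thesis by (auto simp: T_def)
  qed
  define e :: real where "e = 1 / 2 ^ (L + 6)"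
  have e: "0 < e" "e \<le> 1" by (auto simp: e_def field_simps)
  have "card (V - T) \<le> q" using card_mono[of V "V - T"] fin q by auto
  moreover have "2 ^ (L + 4 + 1) * (2 / e) ^ (d * (L + 4)) * real q \<le> real (card Y)"
  proof -
    have "2 / e = 2 ^ (L + 7)" by (simp add: e_def power_add)
    then show ?thesis using Y by (simp add: add.commute)
  qed
  ultimately obtain S where S: "S \<subseteq> Y" "card S = 2 ^ (L + 4) * q"
    and sparse: "real (\<Sum>v\<in>S. card (nbhd R v S)) \<le> (1 / 2 ^ (L + 4) + 4 * e) * (real (card S))\<^sup>2"
    using sparse_subset_if_not_embeds[OF E R(1) _ fin(3) e deg' _ q(2) no', of "L + 4"] fin by blast
  have "finite S" using S fin finite_subset by blast
  define x :: real where "x = 1 / 2 ^ L"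
  have "1 / 2 ^ (L + 4) + 4 * e = x / 8" by (simp add: x_def e_def power_add)
  note sparse = sparse[unfolded this]
  have "(2::real) ^ 1 \<le> 2 ^ L" using L by (intro power_increasing) auto
  then have x: "0 < x" "x \<le> 1 / 2" by (auto simp: x_def field_simps)
  have "1 * q \<le> 2 ^ (L + 4) * q" by (intro mult_right_mono) auto
  then have qS: "q \<le> card S" using S by simp
  then have "16 * t' \<le> card S" using q by linarith
  have "real q * x ^ (2 * a + 1) \<le> real (card S) * x ^ (2 * a + 1)"
    using qS x by (intro mult_right_mono) auto
  then have size': "8 * (M + 1) * (1 + x) ^ (3 * t' + a + 1) \<le> real (card S) * x ^ (2 * a + 1)"
    using size unfolding x_def by linarith
  obtain C X' Y' where "C \<in> {R, co R}" "X' \<subseteq> S" "Y' \<subseteq> S" "mono_pair C X' Y'" "t' \<le> card X'" "M \<le> real (card Y')"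
    using sparse_mono_pair[OF R \<open>finite S\<close> x M sparse a[folded x_def] t' \<open>16 * t' \<le> card S\<close> size']
    by blast
  then show ?thesis using S by (intro exI[of _ C] exI[of _ X'] exI[of _ Y']) auto
qed

text \<open>The price of round \<open>i\<close> in the exponent is at most \<open>k * (4i\<^sup>2 + 90i + 374) / (16 * 2 ^ i)\<close>.  By this
inequality it is at most \<open>24 * k * (3/4) ^ i\<close>.\<close>

lemma cost_bound: "4 * (real i)\<^sup>2 + 90 * real i + 374 \<le> 384 * (3 / 2) ^ i"
proof (induction i)
  case (Suc i)
  have "4 * (real (Suc i))\<^sup>2 + 90 * real (Suc i) + 374
      \<le> (3 / 2) * (4 * (real i)\<^sup>2 + 90 * real i + 374)"
    by (simp add: power2_eq_square algebra_simps)
  with Suc show ?case by simp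
qed simp

lemma one_plus_power_le:
  assumes "0 \<le> x"
  shows "(1 + x) ^ n \<le> 2 powr (2 * x * real n)"
proof -
  have "1 / 2 \<le> ln (2::real)" using ln_le_minus_one[of "1 / 2"] by (simp add: ln_div)
  then have x_le: "x \<le> 2 * x * ln 2" using assms mult_left_mono[of "1 / 2" "ln 2" "2 * x"] by simp
  have "1 + x \<le> exp x" by simp
  also have "\<dots> \<le> exp (2 * x * ln 2)" using x_le by (simp only: exp_le_cancel_iff)
  also have "\<dots> = 2 powr (2 * x)" by (simp add: powr_def)
  finally have "(1 + x) ^ n \<le> (2 powr (2 * x)) ^ n" using assms by (intro power_mono) auto
  also have "\<dots> = 2 powr (2 * x * real n)" by (simp add: powr_realpow[symmetric] powr_powr)
  finally show ?thesis .
qed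

text \<open>The exponent that is still available before round \<open>i\<close>: it starts at \<open>100k\<close>, round \<open>i\<close>
may spend \<open>24 * k * (3/4) ^ i\<close>, and \<open>4k\<close> is never spent, which keeps all host sets larger than the number of vertices
to be embedded and than the cliques to be found, both at most quadratic in \<open>k\<close>.\<close>

definition reserve :: "nat \<Rightarrow> nat \<Rightarrow> real" where
  "reserve k i = real k * (4 + 96 * (3 / 4) ^ i)"

text \<open>Round \<open>i\<close> doubles \<open>X\<close> and uses \<open>x = 2 ^ -(2i + 8)\<close>.  In terms of \<open>w = k / 2 ^ i\<close> the remaining maximum degree is
at most \<open>w/16\<close> and \<open>x * t' = w/4\<close>, so both prices are \<open>w\<close> times a polynomial in \<open>i\<close>.  The additive terms, linear
in \<open>i\<close>, are absorbed because \<open>w > 16\<close>.\<close>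

lemma mono_pair_iterate:
  assumes E: "symp E" "irreflp E" and R: "symp R" "irreflp R"
    and fin: "finite V" "finite X" "finite Y"
    and V: "card V \<le> 2 * k\<^sup>2" "(\<Sum>v\<in>V. card (nbhd E v V)) \<le> 2 * k\<^sup>2"
    and XY: "mono_pair R X Y" "2 ^ (i + 5) * k \<le> card X" and Y: "2 powr reserve k i \<le> real (card Y)"
    and no: "\<not> embeds V E R (X \<union> Y)" and k: "2 ^ (i + 4) < k"
  shows "\<exists>C X' Y'. C \<in> {R, co R} \<and> X' \<subseteq> Y \<and> Y' \<subseteq> Y \<and> mono_pair C X' Y' \<and>
    2 ^ (i + 6) * k \<le> card X' \<and> 2 powr reserve k (Suc i) \<le> real (card Y')"
proof -
  define w where "w = real k / 2 ^ i"
  define L where "L = 2 * i + 8"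
  define t where "t = 2 ^ (i + 5) * k"
  define t' where "t' = 2 ^ (i + 6) * k"
  define D where "D = (\<Sum>v\<in>V. card (nbhd E v V))"
  define d where "d = D div t"
  define x :: real where "x = 1 / 2 ^ L"
  define a where "a = nat \<lfloor>2 * x * real t'\<rfloor>"
  define F' where "F' = reserve k (Suc i)"
  \<comment> \<open>\<open>2 ^ z\<close> is what the sparse subset needs: the target \<open>2 powr F'\<close>, the factor \<open>16\<close> that covers \<open>8 * (2 powr F' + 1)\<close>,
    the factor \<open>2 powr (10 * x * t')\<close> from the powers of \<open>1 + x\<close>, and the inverse of \<open>x ^ (2 * a + 1)\<close>.\<close>
  define z where "z = nat \<lceil>F' + 4 + 10 * (w / 4) + real L * (w + 1)\<rceil>"
  have k0: "0 < k" using k by simp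
  then have t0: "0 < t" "0 < t'" by (auto simp: t_def t'_def)
  have kw: "real k = w * 2 ^ i" by (simp add: w_def)
  have "real (2 ^ (i + 4)) < real k" using k by (simp only: of_nat_less_iff)
  then have w16: "16 < w" by (simp add: w_def power_add field_simps)
  have F'4: "4 * real k \<le> F'" by (simp add: F'_def reserve_def algebra_simps)
  have xt: "x * real t' = w / 4"
  proof -
    have "(2::real) ^ L = 2 ^ i * 2 ^ i * 256" unfolding L_def mult_2 power_add by simp
    then show ?thesis by (simp add: x_def t'_def kw power_add)
  qed
  have x: "0 < x" "x \<le> 1 / 256"
  proof -
    have "(2::real) ^ 8 \<le> 2 ^ L" by (intro power_increasing) (auto simp: L_def)
    then show "0 < x" "x \<le> 1 / 256" by (auto simp: x_def field_simps)
  qed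
  have a: "real a \<le> 2 * x * real t'" "2 * x * real t' < real a + 1"
    using x by (auto simp: a_def)
  have aw: "real a \<le> w / 2" using a(1) xt by simp
  have zz: "F' + 4 + 10 * (w / 4) + real L * (w + 1) \<le> real z"
    unfolding z_def by linarith
  have z_le: "real z \<le> F' + 5 + 10 * (w / 4) + real L * (w + 1)"
  proof -
    have "0 \<le> F' + 4 + 10 * (w / 4) + real L * (w + 1)" using F'4 w16 by simp
    then show ?thesis unfolding z_def by linarith
  qed
  have z4k: "4 * k \<le> z"
  proof -
    have "0 \<le> real L * (w + 1)" using w16 by simp
    then have "real (4 * k) \<le> real z" using zz F'4 w16 by linarith
    then show ?thesis by (simp only: of_nat_le_iff)
  qed
  have q_big: "64 * k\<^sup>2 \<le> 2 ^ z"
  proof -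
    have "k\<^sup>2 \<le> (2 ^ k)\<^sup>2" by (intro power_mono) (auto intro: less_imp_le)
    then have "64 * k\<^sup>2 \<le> 2 ^ 6 * (2 ^ k)\<^sup>2" by simp
    also have "\<dots> = 2 ^ (6 + 2 * k)" by (simp add: power_add power_mult[symmetric] mult.commute)
    also have "\<dots> \<le> 2 ^ z"
    proof -
      have "(2::nat) ^ 4 \<le> 2 ^ (i + 4)" by (intro power_increasing) auto
      then have "6 \<le> 2 * k" using k by simp
      then show ?thesis using z4k by (intro power_increasing) auto
    qed
    finally show ?thesis .
  qed
  have "16 * t' = 64 * (2 ^ (i + 4) * k)" by (simp add: t'_def power_add)
  also have "\<dots> \<le> 64 * (k * k)" using k by (intro mult_left_mono mult_right_mono) auto
  finally have q16: "16 * t' \<le> 2 ^ z" using q_big by (simp add: power2_eq_square)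
  have qV: "card V \<le> 2 ^ z" using V(1) q_big by linarith
  have D: "D < (d + 1) * t"
    using dividend_less_div_times[OF t0(1), of D] by (simp add: d_def)
  have dw: "real d \<le> w / 16"
  proof -
    have "real d \<le> real D / real t" unfolding d_def by (rule of_nat_div_le_of_nat)
    also have "\<dots> \<le> real (2 * k\<^sup>2) / real t"
      using V(2) by (intro divide_right_mono) (simp_all only: D_def of_nat_le_iff of_nat_0_le_iff)
    also have "\<dots> = w / 16" using k0 by (simp add: t_def w_def power_add power2_eq_square)
    finally show ?thesis .
  qed
  \<comment> \<open>What the round spends is at most the difference of the two reserves.\<close>
  have "2 ^ (L + 5) * (2 ^ (L + 7)) ^ (d * (L + 4)) * real (2 ^ z)
      = 2 powr (real (L + 5 + (L + 7) * (d * (L + 4)) + z))"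
    by (subst powr_realpow) (simp_all add: power_add power_mult)
  also have "\<dots> \<le> 2 powr reserve k i"
  proof (rule powr_mono)
    define I where "I = real i"
    have I: "0 \<le> I" by (simp add: I_def)
    have rL: "real L = 2 * I + 8" by (simp add: L_def I_def)
    have "real d * ((2 * I + 15) * (2 * I + 12)) \<le> w / 16 * ((2 * I + 15) * (2 * I + 12))"
      using dw I by (intro mult_right_mono) auto
    moreover have "16 * (4 * I + 26) \<le> w * (4 * I + 26)"
      using w16 I by (intro mult_right_mono) auto
    moreover have "w * (4 * I\<^sup>2 + 90 * I + 374) \<le> w * (384 * (3 / 2) ^ i)"
      using cost_bound[of i] w16 unfolding I_def by (intro mult_left_mono) auto
    moreover have "reserve k i - F' = w * (24 * (3 / 2) ^ i)"
    proof -
      have "(2::real) ^ i * (3 / 4) ^ i = (3 / 2) ^ i"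
        by (simp add: power_mult_distrib[symmetric])
      then show ?thesis by (simp add: F'_def reserve_def kw algebra_simps)
    qed
    ultimately show "real (L + 5 + (L + 7) * (d * (L + 4)) + z) \<le> reserve k i"
      using z_le unfolding of_nat_add of_nat_mult rL
      by (simp add: algebra_simps power2_eq_square)
  qed simp
  finally have Yq: "2 ^ (L + 5) * (2 ^ (L + 7)) ^ (d * (L + 4)) * real (2 ^ z) \<le> real (card Y)"
    using Y by linarith
  have size: "8 * (2 powr F' + 1) * (1 + x) ^ (3 * t' + a + 1) \<le> real (2 ^ z) * x ^ (2 * a + 1)"
  proof -
    have "1 \<le> 2 powr F'" using F'4 by (intro ge_one_powr_ge_zero) auto
    have "2 * x * real (3 * t' + a + 1) \<le> 10 * (w / 4)"
    proof -
      have "2 * x * real t' \<le> 1 * real t'" using x by (intro mult_right_mono) auto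
      moreover have "1 \<le> real t'" using t0 by simp
      ultimately have "real (3 * t' + a + 1) \<le> 5 * real t'" using a(1) by linarith
      then have "2 * x * real (3 * t' + a + 1) \<le> 2 * x * (5 * real t')"
        using x by (intro mult_left_mono) auto
      also have "\<dots> = 10 * (x * real t')" by simp
      finally show ?thesis unfolding xt .
    qed
    then have pow: "(1 + x) ^ (3 * t' + a + 1) \<le> 2 powr (10 * (w / 4))"
      using one_plus_power_le[of x "3 * t' + a + 1"] x
      by (meson less_imp_le one_le_numeral order_trans powr_mono)
    have "8 * (2 powr F' + 1) * (1 + x) ^ (3 * t' + a + 1)
        \<le> (2 powr 4 * 2 powr F') * 2 powr (10 * (w / 4))"
    proof (rule mult_mono)
      show "8 * (2 powr F' + 1) \<le> 2 powr 4 * 2 powr F'" using \<open>1 \<le> 2 powr F'\<close> by simp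
    qed (use pow x in auto)
    also have "\<dots> = 2 powr (F' + 4 + 10 * (w / 4))"
      by (simp only: powr_add mult_ac)
    also have "\<dots> \<le> 2 powr (real z - real L * real (2 * a + 1))"
    proof (rule powr_mono)
      have "real L * real (2 * a + 1) \<le> real L * (w + 1)"
        using aw by (intro mult_left_mono) auto
      then show "F' + 4 + 10 * (w / 4) \<le> real z - real L * real (2 * a + 1)" using zz by linarith
    qed simp
    also have "\<dots> = 2 powr (real z) / 2 powr (real (L * (2 * a + 1)))"
      by (simp only: powr_diff of_nat_mult)
    also have "\<dots> = 2 ^ z / 2 ^ (L * (2 * a + 1))"
      by (simp only: powr_realpow zero_less_numeral)
    also have "\<dots> = real (2 ^ z) * x ^ (2 * a + 1)"
      by (simp only: x_def power_inverse power_mult of_nat_power of_nat_numeral divide_inverse mult_1)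
    finally show ?thesis .
  qed
  have "\<exists>C X' Y'. C \<in> {R, co R} \<and> X' \<subseteq> Y \<and> Y' \<subseteq> Y \<and> mono_pair C X' Y' \<and> t' \<le> card X' \<and>
      2 powr F' \<le> real (card Y')"
    by (rule mono_pair_step[OF E R fin XY(1) XY(2)[folded t_def] no D[unfolded D_def] qV _ q16 Yq _
          t0(2) _ a[unfolded x_def] size[unfolded x_def]]) (simp_all add: L_def)
  then show ?thesis by (simp add: t'_def F'_def)
qed

text \<open>Suppose that neither colour contains the graph.  A monochromatic pair whose \<open>X\<close> has at least \<open>2k\<^sup>2\<close> vertices
would contain it in \<open>X\<close> alone, hence \<open>2 ^ (i + 4) < k\<close> holds whenever round \<open>i\<close> is reached, which is
what a further round requires.  So the rounds never stop, which is absurd since \<open>2 ^ i\<close> cannot stay below \<open>k\<close>.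
The budget of \<open>166k\<close> consists of \<open>64k\<close> for the first pair, the initial reserve \<open>100k\<close>, and \<open>2k\<close> for rounding.\<close>

lemma embeds_monochromatic:
  assumes E: "symp E" "irreflp E" and R: "symp R" "irreflp R" and fin: "finite V" "finite W"
    and V: "card V \<le> 2 * k\<^sup>2" "(\<Sum>v\<in>V. card (nbhd E v V)) \<le> 2 * k\<^sup>2" and k: "0 < k"
    and W: "2 ^ (166 * k) \<le> card W"
  shows "embeds V E R W \<or> embeds V E (co R) W"
proof (rule ccontr)
  assume "\<not> ?thesis"
  then have no: "\<not> embeds V E C W" if "C \<in> {R, co R}" for C using that by auto
  have sub_no: "\<not> embeds V E C (X \<union> Y)" if "C \<in> {R, co R}" "X \<subseteq> W" "Y \<subseteq> W" for C X Y
    using no[OF that(1)] embeds_mono[of V E C "X \<union> Y" W] that(2,3) by blast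
  have C: "symp C" "irreflp C" "{C, co C} = {R, co R}" if "C \<in> {R, co R}" for C
    using that R symp_co[OF R(1)] irreflp_co[of R] co_co[OF R(2)] by auto
  have small: "2 ^ (i + 4) < k"
    if "C \<in> {R, co R}" "X \<subseteq> W" "mono_pair C X Y" "2 ^ (i + 5) * k \<le> card X" for C X Y i
  proof (rule ccontr)
    assume "\<not> ?thesis"
    then have "2 * k * k \<le> 2 * 2 ^ (i + 4) * k" by (intro mult_right_mono) auto
    also have "\<dots> = 2 ^ (i + 5) * k" by (simp add: power_add)
    finally have "card V \<le> card X" using V(1) that(4) unfolding power2_eq_square by linarith
    have "mono_pair C X {}" using that(3) by (simp add: mono_pair_def)
    then have "embeds V E C (X \<union> {})"
      using finite_subset[OF that(2) fin(2)] fin(1) \<open>card V \<le> card X\<close>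
      by (rule embeds_mono_pair[OF C(2)[OF that(1)] _ _ _ _ E C(1)[OF that(1)]])
        (simp add: embeds_def)
    then show False using sub_no[OF that(1,2), of "{}"] by simp
  qed
  have grow: "\<exists>C X Y. C \<in> {R, co R} \<and> X \<subseteq> W \<and> Y \<subseteq> W \<and> mono_pair C X Y \<and>
      2 ^ (i + 5) * k \<le> card X \<and> 2 powr reserve k i \<le> real (card Y)" for i
  proof (induction i)
    case 0
    have "(2::real) ^ (100 * k) + 1 \<le> 2 ^ (100 * k) + 2 ^ (100 * k)" by simp
    also have "\<dots> = 2 ^ (100 * k + 1)" by simp
    also have "\<dots> \<le> 2 ^ (102 * k)" using k by (intro power_increasing) auto
    also have "\<dots> = 2 ^ (102 * k + 32 * k + 32 * k) * (1 / 2) ^ (32 * k) * (1 / 2) ^ (32 * k)"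
      by (simp only: power_add power_one_over) simp
    also have "\<dots> = real (2 ^ (166 * k)) * (1 / 2) ^ (32 * k) * (1 / 2) ^ (32 * k)" by simp
    also have "\<dots> \<le> (real (card W) + 1) * (1 / 2) ^ (32 * k) * (1 / 2) ^ (32 * k)"
    proof -
      have "real (2 ^ (166 * k)) \<le> real (card W)" using W by (simp only: of_nat_le_iff)
      then have "real (2 ^ (166 * k)) \<le> real (card W) + 1" by linarith
      then show ?thesis by (intro mult_right_mono) simp_all
    qed
    finally have "2 ^ (100 * k) + 1 \<le> (real (card W) + 1) * (1 / 2) ^ (32 * k) * (1 / 2) ^ (32 * k)" .
    from erdos_szekeres_pair[OF R _ _ _ _ fin(2) this]
    obtain C X Y where "C \<in> {R, co R}" "X \<subseteq> W" "Y \<subseteq> W" "mono_pair C X Y" "card X = 32 * k"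
      "2 ^ (100 * k) \<le> real (card Y)" by auto
    moreover have "2 powr reserve k 0 = 2 ^ (100 * k)"
      by (simp add: reserve_def powr_realpow[symmetric] mult.commute)
    ultimately show ?case by (intro exI[of _ C] exI[of _ X] exI[of _ Y]) auto
  next
    case (Suc i)
    then obtain C X Y where CXY: "C \<in> {R, co R}" "X \<subseteq> W" "Y \<subseteq> W" "mono_pair C X Y"
      "2 ^ (i + 5) * k \<le> card X" "2 powr reserve k i \<le> real (card Y)" by blast
    obtain C' X' Y' where n: "C' \<in> {C, co C}" "X' \<subseteq> Y" "Y' \<subseteq> Y" "mono_pair C' X' Y'"
      "2 ^ (i + 6) * k \<le> card X'" "2 powr reserve k (Suc i) \<le> real (card Y')"
      using mono_pair_iterate[OF E C(1,2)[OF CXY(1)] fin(1) finite_subset[OF CXY(2) fin(2)]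
          finite_subset[OF CXY(3) fin(2)] V CXY(4,5,6) sub_no[OF CXY(1,2,3)] small[OF CXY(1,2,4,5)]]
      by blast
    have "C' \<in> {R, co R}" using n(1) C(3)[OF CXY(1)] by blast
    moreover have "X' \<subseteq> W" "Y' \<subseteq> W" using n(2,3) CXY(3) by auto
    ultimately show ?case
      using n(4,5,6) by (intro exI[of _ C'] exI[of _ X'] exI[of _ Y']) (simp add: power_add)
  qed
  obtain C X Y where "C \<in> {R, co R}" "X \<subseteq> W" "mono_pair C X Y" "2 ^ (k + 5) * k \<le> card X"
    using grow[of k] by blast
  from small[OF this] have "2 ^ (k + 4) < k" .
  moreover have "k < 2 ^ k" by simp
  moreover have "(2::nat) ^ k \<le> 2 ^ (k + 4)" by (intro power_increasing) auto
  ultimately show False by linarith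
qed

section \<open>Ramsey numbers of graphs\<close>

text \<open>A copy of \<open>G\<close> in the sense of the definition is the image of \<open>G\<close> under the embedding, with exactly the image edges.\<close>

lemma ramsey_property_if_embeds:
  assumes G: "simple_graph G"
    and emb: "\<And>c :: nat set \<Rightarrow> color. \<exists>k. embeds (verts G) (\<lambda>u v. {u, v} \<in> edges G)
      (\<lambda>u v. u \<noteq> v \<and> c {u, v} = k) {..<N}"
  shows "ramsey_property G N"
  unfolding ramsey_property_def
proof
  fix c :: "nat set \<Rightarrow> color"
  obtain k f where f: "inj_on f (verts G)" "f ` verts G \<subseteq> {..<N}"
    and mono: "\<And>u v. u \<in> verts G \<Longrightarrow> v \<in> verts G \<Longrightarrow> {u, v} \<in> edges G \<Longrightarrow> c {f u, f v} = k"
  proof -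
    from emb[of c] obtain k where "embeds (verts G) (\<lambda>u v. {u, v} \<in> edges G)
      (\<lambda>u v. u \<noteq> v \<and> c {u, v} = k) {..<N}" ..
    then obtain f where "inj_on f (verts G)" "f ` verts G \<subseteq> {..<N}"
      "\<forall>u\<in>verts G. \<forall>v\<in>verts G. {u, v} \<in> edges G \<longrightarrow> f u \<noteq> f v \<and> c {f u, f v} = k"
      unfolding embeds_def by blast
    then show thesis by (intro that[of f k]) simp_all
  qed
  have fin: "finite (verts G)" and edgesG: "edges G \<subseteq> nsets (verts G) 2"
    using G by (auto simp: simple_graph_def)
  have bij: "bij_betw f (verts G) (f ` verts G)" using f(1) by (simp add: bij_betw_def)
  define H where "H = (f ` verts G, (`) f ` edges G)"
  have sub: "edges H \<subseteq> nsets (verts H) 2"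
    using edgesG bij_betw_nsets[OF bij, of 2] by (auto simp: H_def bij_betw_def)
  have "simple_graph H" using fin sub by (simp add: simple_graph_def H_def)
  moreover have "nsets (verts H) 2 \<subseteq> nsets {..<N} 2"
    using f(2) by (intro nsets_mono) (simp add: H_def)
  ultimately have "subgraph H (complete_graph N)"
    using f(2) sub by (auto simp: subgraph_def complete_graph_def H_def)
  moreover have "graph_isomorphic G H"
    unfolding graph_isomorphic_def
  proof (intro exI[of _ f] conjI ballI)
    show "bij_betw f (verts G) (verts H)" using bij by (simp add: H_def)
    fix u v assume uv: "u \<in> verts G" "v \<in> verts G"
    show "{u, v} \<in> edges G \<longleftrightarrow> {f u, f v} \<in> edges H"
    proof
      assume "{u, v} \<in> edges G"
      from imageI[OF this, of "(`) f"] show "{f u, f v} \<in> edges H" by (simp add: H_def)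
    next
      assume "{f u, f v} \<in> edges H"
      then obtain e where e: "e \<in> edges G" "f ` {u, v} = f ` e" by (auto simp: H_def)
      then have "e \<subseteq> verts G" using edgesG by (auto simp: nsets_def)
      then have "{u, v} = e" using inj_on_image_eq_iff[OF f(1), of "{u, v}" e] e uv by simp
      then show "{u, v} \<in> edges G" using e by simp
    qed
  qed
  moreover have "c e' = k" if e': "e' \<in> edges H" for e'
  proof -
    obtain e where e: "e \<in> edges G" "e' = f ` e" using e' by (auto simp: H_def)
    then have "e \<in> nsets (verts G) 2" using edgesG by blast
    then obtain u v where "e = {u, v}" "u \<in> verts G" "v \<in> verts G"
      by (auto simp: nsets_def card_2_iff)
    then show ?thesis using mono[of u v] e by simp
  qed
  ultimately show "\<exists>H k. subgraph H (complete_graph N) \<and> graph_isomorphic G H \<and> (\<forall>e\<in>edges H. c e = k)"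
    by blast
qed

text \<open>The handshake lemma.\<close>

lemma sum_degrees_le:
  assumes "simple_graph G"
  shows "(\<Sum>v\<in>verts G. card (nbhd (\<lambda>u v. {u, v} \<in> edges G) v (verts G))) \<le> 2 * card (edges G)"
proof -
  have fin: "finite (verts G)" and edgesG: "edges G \<subseteq> nsets (verts G) 2"
    using assms by (auto simp: simple_graph_def)
  then have finE: "finite (edges G)" using finite_imp_finite_nsets finite_subset by blast
  have "card (nbhd (\<lambda>u v. {u, v} \<in> edges G) v (verts G)) \<le> card {e \<in> edges G. v \<in> e}" for v
    using finE by (intro card_inj_on_le[of "\<lambda>u. {v, u}"]) (auto simp: nbhd_def inj_on_def doubleton_eq_iff)
  then have "(\<Sum>v\<in>verts G. card (nbhd (\<lambda>u v. {u, v} \<in> edges G) v (verts G)))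
      \<le> (\<Sum>v\<in>verts G. card {e \<in> edges G. v \<in> e})" by (rule sum_mono)
  also have "\<dots> = (\<Sum>e\<in>edges G. 2)"
  proof (rule sum_multicount_gen[OF fin finE], intro ballI)
    fix e assume "e \<in> edges G"
    then have "e \<subseteq> verts G" "card e = 2" using edgesG by (auto simp: nsets_def)
    then have "{v \<in> verts G. v \<in> e} = e" by auto
    then show "card {v \<in> verts G. v \<in> e} = 2" using \<open>card e = 2\<close> by simp
  qed
  finally show ?thesis by (simp add: mult.commute)
qed

theorem theorem1p1:
  fixes G :: "'v graph" and m :: nat
  assumes "simple_graph G"
    and "card (edges G) = m"
    and "\<not> (\<exists>v. isolated_vertex G v)"
  shows "real (ramsey_number G) \<le> 2 powr (250 * sqrt (real m))"
proof -
  define V where "V = verts G"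
  define E where "E u v \<longleftrightarrow> {u, v} \<in> edges G" for u v
  have fin: "finite V" and edgesG: "edges G \<subseteq> nsets V 2"
    using assms(1) by (auto simp: simple_graph_def V_def)
  have pair: "u \<noteq> v" if "{u, v} \<in> edges G" for u v
    using that edgesG by (auto simp: nsets_def)
  have E: "symp E" "irreflp E"
    using pair[of v v for v] unfolding symp_def irreflp_def E_def by (auto simp: insert_commute)
  have deg: "(\<Sum>v\<in>V. card (nbhd E v V)) \<le> 2 * m"
    using sum_degrees_le[OF assms(1)] assms(2) unfolding E_def[abs_def] V_def by simp
  have "1 \<le> card (nbhd E v V)" if v: "v \<in> V" for v
  proof -
    obtain e where e: "e \<in> edges G" "v \<in> e"
      using assms(3) v unfolding isolated_vertex_def V_def by blast
    then have "e \<in> nsets V 2" using edgesG by blast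
    then obtain u where "e = {v, u}" "u \<in> V"
      using e(2) by (auto simp: nsets_def card_2_iff)
    then have "u \<in> nbhd E v V" using e by (simp add: nbhd_def E_def)
    then show ?thesis using fin by (metis One_nat_def Suc_leI card_gt_0_iff empty_iff finite_nbhd)
  qed
  then have "(\<Sum>v\<in>V. 1) \<le> (\<Sum>v\<in>V. card (nbhd E v V))" by (intro sum_mono)
  then have cV: "card V \<le> 2 * m" using deg by simp
  show ?thesis
  proof (cases "m = 0")
    case True
    then have "V = {}" using cV fin by simp
    then have "ramsey_property G 0"
      by (intro ramsey_property_if_embeds[OF assms(1)]) (simp add: embeds_def V_def)
    then have "ramsey_number G \<le> 0" unfolding ramsey_number_def by (rule Least_le)
    then show ?thesis by simp
  next
    case False
    define k where "k = nat \<lceil>sqrt (real m)\<rceil>"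
    have "0 < sqrt (real m)" using False by simp
    then have k: "0 < k" "sqrt (real m) \<le> real k" "real k < sqrt (real m) + 1"
      unfolding k_def by linarith+
    have "real m = (sqrt (real m))\<^sup>2" by simp
    also have "\<dots> \<le> (real k)\<^sup>2" using k by (intro power_mono) auto
    finally have mk: "m \<le> k\<^sup>2" by (simp only: of_nat_power[symmetric] of_nat_le_iff)
    have "ramsey_property G (2 ^ (166 * k))"
    proof (rule ramsey_property_if_embeds[OF assms(1)])
      fix c :: "nat set \<Rightarrow> color"
      define R where "R u v \<longleftrightarrow> u \<noteq> v \<and> c {u, v} = Red" for u v
      have R: "symp R" "irreflp R" by (auto simp: symp_def irreflp_def R_def insert_commute)
      have "c s \<noteq> Red \<longleftrightarrow> c s = Blue" for s by (cases "c s") auto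
      then have blue: "co R = (\<lambda>u v. u \<noteq> v \<and> c {u, v} = Blue)"
        by (auto simp: co_def R_def fun_eq_iff)
      have red: "R = (\<lambda>u v. u \<noteq> v \<and> c {u, v} = Red)" by (simp add: R_def fun_eq_iff)
      have EV: "E = (\<lambda>u v. {u, v} \<in> edges G)" by (simp add: E_def fun_eq_iff)
      have "embeds V E R {..<2 ^ (166 * k)} \<or> embeds V E (co R) {..<2 ^ (166 * k)}"
        using deg cV mk k by (intro embeds_monochromatic[OF E R fin, where k = k]) auto
      then show "\<exists>l. embeds (verts G) (\<lambda>u v. {u, v} \<in> edges G)
          (\<lambda>u v. u \<noteq> v \<and> c {u, v} = l) {..<2 ^ (166 * k)}"
        unfolding blue unfolding red EV V_def by (elim disjE) (rule exI, assumption)+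
    qed
    then have "ramsey_number G \<le> 2 ^ (166 * k)" unfolding ramsey_number_def by (rule Least_le)
    then have "real (ramsey_number G) \<le> real (2 ^ (166 * k))" by (simp only: of_nat_le_iff)
    also have "\<dots> = 2 powr (real (166 * k))" by (subst powr_realpow) simp_all
    also have "\<dots> \<le> 2 powr (250 * sqrt (real m))"
    proof (rule powr_mono)
      \<comment> \<open>Rounding \<open>\<surd>m\<close> up costs least for large \<open>m\<close>; the worst case is \<open>m = 2\<close>, with \<open>332 \<le> 250 * \<surd>2\<close>.\<close>
      consider "m = 1" | "m = 2" | "m = 3" | "4 \<le> m" using False by linarith
      then show "real (166 * k) \<le> 250 * sqrt (real m)"
      proof cases
        case 1
        then have "k = 1" by (simp add: k_def)
        then show ?thesis using 1 by simp
      next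
        case 2
        have "sqrt 2 \<le> sqrt (2\<^sup>2)" by (intro real_sqrt_le_mono) simp
        then have "k \<le> 2" using 2 by (simp add: k_def nat_le_iff ceiling_le_iff)
        moreover have "1.4 \<le> sqrt 2" by (rule real_le_rsqrt) (simp add: power2_eq_square)
        ultimately show ?thesis using 2 by simp
      next
        case 3
        have "sqrt 3 \<le> sqrt (2\<^sup>2)" by (intro real_sqrt_le_mono) simp
        then have "k \<le> 2" using 3 by (simp add: k_def nat_le_iff ceiling_le_iff)
        moreover have "1.4 \<le> sqrt 3" by (rule real_le_rsqrt) (simp add: power2_eq_square)
        ultimately show ?thesis using 3 by simp
      next
        case 4
        then have "2 \<le> sqrt (real m)" by (intro real_le_rsqrt) simp
        then show ?thesis using k(3) by simp
      qed
    qed simp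
    finally show ?thesis .
  qed
qed

end
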